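(* Let $\alpha(s)=(x(s),z(s))$ be a regular curve in $\mathbb{R}^2$ parametrized by arc length, and let $$\xi_1(s)=x(s)x'(s)+z(s)z'(s),\qquad \xi_2(s)=-x(s)z'(s)+z(s)x'(s).$$ Then the TreadmillSled of $\alpha$ is the curve $s\mapsto -(\xi_1(s),\xi_2(s))$.
   Context: TreadmillSled: given a regular curve $\alpha$ in the plane, its TreadmillSled is the trace of the origin of the plane containing $\alpha$ when this plane (together with the curve) rolls on a treadmill located at the origin and aligned along the $x$-axis. Precisely: for each $s$ let $T_s:\mathbb{R}^2\to\mathbb{R}^2$ be the unique orientation-preserving isometry (a rotation followed by a translation) that takes the point $\alpha(s)$ to $(0,0)$ and whose linear part takes the unit tangent vector $\alpha'(s)$ to $(1,0)$. The TreadmillSled of $\alpha$ is the curve $s\mapsto T_s(0,0)$. *)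

theory Defs
  imports "HOL-Analysis.Analysis"
begin

(* One-sided derivatives are used at endpoints belonging to I. *)
definition velocity :: "real set \<Rightarrow> (real \<Rightarrow> real^2) \<Rightarrow> real \<Rightarrow> real^2" where
  "velocity I \<alpha> s = vector_derivative \<alpha> (at s within I)"

(* Regular means C^1 with nowhere vanishing velocity, on a nondegenerate interval
   that may be open, closed, half-open or unbounded. *)
definition regular_curve :: "real set \<Rightarrow> (real \<Rightarrow> real^2) \<Rightarrow> bool" where
  "regular_curve I \<alpha> \<longleftrightarrow>
     is_interval I \<and> interior I \<noteq> {} \<and>
     (\<forall>s\<in>I. \<alpha> differentiable (at s within I)) \<and>
     continuous_on I (velocity I \<alpha>) \<and>
     (\<forall>s\<in>I. velocity I \<alpha> s \<noteq> 0)"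

definition arc_length_parametrized :: "real set \<Rightarrow> (real \<Rightarrow> real^2) \<Rightarrow> bool" where
  "arc_length_parametrized I \<alpha> \<longleftrightarrow> (\<forall>s\<in>I. norm (velocity I \<alpha> s) = 1)"

(* sgn v = v / norm v, so this is the velocity itself for arc-length parametrizations. *)
definition unit_tangent :: "real set \<Rightarrow> (real \<Rightarrow> real^2) \<Rightarrow> real \<Rightarrow> real^2" where
  "unit_tangent I \<alpha> s = sgn (velocity I \<alpha> s)"

(* For an isometry T (hence affine) this is its linear part. *)
definition linear_part :: "(real^2 \<Rightarrow> real^2) \<Rightarrow> real^2 \<Rightarrow> real^2" where
  "linear_part T v = T v - T 0"

definition orientation_preserving_isometry :: "(real^2 \<Rightarrow> real^2) \<Rightarrow> bool" where
  "orientation_preserving_isometry T \<longleftrightarrow>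
     (\<forall>p q. dist (T p) (T q) = dist p q) \<and> det (matrix (linear_part T)) > 0"

lemma orientation_preserving_isometry_iff_rotation_translation:
  "orientation_preserving_isometry T \<longleftrightarrow>
     (\<exists>R b. rotation_matrix R \<and> T = (\<lambda>p. R *v p + b))"
proof
  assume T: "orientation_preserving_isometry T"
  then have orth: "orthogonal_transformation (linear_part T)"
    by (auto simp: orientation_preserving_isometry_def orthogonal_transformation_isometry
        linear_part_def dist_norm)
  then have R: "orthogonal_matrix (matrix (linear_part T))"
    and lin: "linear (linear_part T)"
    by (auto simp: orthogonal_transformation_matrix)
  have "det (matrix (linear_part T)) = 1"
    using det_orthogonal_matrix[OF R] T by (auto simp: orientation_preserving_isometry_def)
  moreover have "T = (\<lambda>p. matrix (linear_part T) *v p + T 0)"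
    using lin by (auto simp: matrix_works linear_part_def)
  ultimately show "\<exists>R b. rotation_matrix R \<and> T = (\<lambda>p. R *v p + b)"
    using R unfolding rotation_matrix_def by blast
next
  assume "\<exists>R b. rotation_matrix R \<and> T = (\<lambda>p. R *v p + b)"
  then obtain R b where R: "rotation_matrix R" and T: "T = (\<lambda>p. R *v p + b)" by blast
  have lp: "linear_part T = (*v) R" by (auto simp: linear_part_def T)
  have "orthogonal_transformation ((*v) R)"
    using R by (simp add: orthogonal_transformation_matrix rotation_matrix_def)
  then have "\<forall>p q. dist (T p) (T q) = dist p q"
    by (simp add: orthogonal_transformation_isometry T)
  then show "orientation_preserving_isometry T"
    using R by (simp add: orientation_preserving_isometry_def lp rotation_matrix_def)
qed

definition treadmill_isometry ::
    "real set \<Rightarrow> (real \<Rightarrow> real^2) \<Rightarrow> real \<Rightarrow> (real^2 \<Rightarrow> real^2)" where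
  "treadmill_isometry I \<alpha> s =
     (THE T. orientation_preserving_isometry T \<and>
             T (\<alpha> s) = 0 \<and>
             linear_part T (unit_tangent I \<alpha> s) = vector [1, 0])"

definition treadmill_sled ::
    "real set \<Rightarrow> (real \<Rightarrow> real^2) \<Rightarrow> real \<Rightarrow> real^2" where
  "treadmill_sled I \<alpha> s = treadmill_isometry I \<alpha> s 0"

end

theory Submission
  imports Defs
begin

text \<open>
  A rotation of the plane carrying a unit vector \<open>t\<close> to \<open>(1, 0)\<close> is unique: its first row has
  unit length and inner product \<open>1\<close> with \<open>t\<close>, so it is \<open>t\<close> (the equality case of Cauchy--Schwarz),
  and its second row is orthogonal to \<open>t\<close>, with length and sign fixed by the determinant.
  This is \<open>rotation_to_horizontal_unique\<close>. A direct isometry has the form \<open>p \<mapsto> R p + b\<close>; the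
  condition that it takes \<open>\<alpha> s\<close> to the origin forces \<open>b = - R (\<alpha> s)\<close>. So the isometry exists, is
  unique, and sends the origin to \<open>- R (\<alpha> s)\<close>. With \<open>t = \<alpha>'(s)\<close> the coordinates of \<open>R (\<alpha> s)\<close> are
  the inner products of \<open>\<alpha> s\<close> with \<open>(x', z')\<close> and \<open>(-z', x')\<close>, which are \<open>\<xi>\<^sub>1\<close> and \<open>\<xi>\<^sub>2\<close>.
\<close>

definition rotation_to_horizontal :: "real^2 \<Rightarrow> real^2^2" where
  "rotation_to_horizontal t = vector [vector [t$1, t$2], vector [- t$2, t$1]]"

lemma rotation_to_horizontal_mult:
  "rotation_to_horizontal t *v p = vector [t$1 * p$1 + t$2 * p$2, t$1 * p$2 - t$2 * p$1]"
  by (simp add: rotation_to_horizontal_def vec_eq_iff forall_2 matrix_vector_mult_def sum_2)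

lemma norm_eq_1_vec2: "norm (t :: real^2) = 1 \<longleftrightarrow> (t$1)\<^sup>2 + (t$2)\<^sup>2 = 1"
  by (simp add: norm_vec_def L2_set_def sum_2)

lemma rotation_matrix_rotation_to_horizontal:
  assumes "norm t = 1"
  shows "rotation_matrix (rotation_to_horizontal t)"
  using assms unfolding norm_eq_1_vec2
  by (simp add: rotation_matrix_def orthogonal_matrix rotation_to_horizontal_def det_2
      vec_eq_iff forall_2 matrix_matrix_mult_def transpose_def mat_def sum_2 power2_eq_square
      algebra_simps)

text \<open>
  The conditions \<open>norm t = 1\<close>, unit first row and inner product \<open>1\<close> with \<open>t\<close> make the squared
  distance between \<open>t\<close> and the first row \<open>1 - 2 + 1 = 0\<close>; the determinant then rules out the
  reflection that has the same first row.
\<close>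
lemma rotation_to_horizontal_unique:
  assumes "norm t = 1" "rotation_matrix R" "R *v t = vector [1, 0]"
  shows "R = rotation_to_horizontal t"
proof -
  have t: "(t$1)\<^sup>2 + (t$2)\<^sup>2 = 1"
    using assms(1) by (simp add: norm_eq_1_vec2)
  have Rt: "R$1$1 * t$1 + R$1$2 * t$2 = 1" "R$2$1 * t$1 + R$2$2 * t$2 = 0"
    using assms(3) by (simp_all add: vec_eq_iff forall_2 matrix_vector_mult_def sum_2)
  have det: "R$1$1 * R$2$2 - R$1$2 * R$2$1 = 1"
    using assms(2) by (simp add: rotation_matrix_def det_2)
  have "R ** transpose R = mat 1"
    using assms(2) by (simp add: rotation_matrix_def orthogonal_matrix_def)
  then have "(R ** transpose R)$1$1 = 1"
    by (simp add: mat_def)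
  then have row: "(R$1$1)\<^sup>2 + (R$1$2)\<^sup>2 = 1"
    by (simp add: matrix_matrix_mult_def transpose_def sum_2 power2_eq_square)
  have "(R$1$1 - t$1)\<^sup>2 + (R$1$2 - t$2)\<^sup>2 = 0"
    using t Rt(1) row by (simp add: power2_diff)
  then have first: "R$1$1 = t$1" "R$1$2 = t$2"
    by (simp_all add: sum_power2_eq_zero_iff)
  have det': "t$1 * R$2$2 - t$2 * R$2$1 = 1"
    using det first by simp
  \<comment> \<open>The second row solves a linear system with determinant \<open>(t$1)\<^sup>2 + (t$2)\<^sup>2 = 1\<close>.\<close>
  have "R$2$2 = t$1" "R$2$1 = - t$2"
    using t Rt(2) det' by algebra+
  with first show ?thesis
    by (simp add: rotation_to_horizontal_def vec_eq_iff forall_2)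
qed

text \<open>
  Uniqueness of the rotation and of the translation turns the definite description into an
  explicit affine map.
\<close>
lemma treadmill_isometry_eq:
  assumes "norm (unit_tangent I \<alpha> s) = 1"
  defines "R \<equiv> rotation_to_horizontal (unit_tangent I \<alpha> s)"
  shows "treadmill_isometry I \<alpha> s = (\<lambda>p. R *v p - R *v \<alpha> s)"
  unfolding treadmill_isometry_def
proof (rule the_equality)
  let ?t = "unit_tangent I \<alpha> s"
  have rot: "rotation_matrix R"
    unfolding R_def by (rule rotation_matrix_rotation_to_horizontal[OF assms(1)])
  have "R *v ?t = vector [1, 0]"
    using assms(1) by (simp add: R_def rotation_to_horizontal_mult norm_eq_1_vec2 power2_eq_square)
  moreover have "orientation_preserving_isometry (\<lambda>p. R *v p - R *v \<alpha> s)"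
    unfolding orientation_preserving_isometry_iff_rotation_translation
    using rot by (intro exI[of _ R] exI[of _ "- (R *v \<alpha> s)"]) simp
  ultimately show "orientation_preserving_isometry (\<lambda>p. R *v p - R *v \<alpha> s) \<and>
      R *v \<alpha> s - R *v \<alpha> s = 0 \<and>
      linear_part (\<lambda>p. R *v p - R *v \<alpha> s) ?t = vector [1, 0]"
    by (simp add: linear_part_def)
next
  fix T
  assume T: "orientation_preserving_isometry T \<and> T (\<alpha> s) = 0 \<and>
    linear_part T (unit_tangent I \<alpha> s) = vector [1, 0]"
  then obtain Q b where Q: "rotation_matrix Q" and Tp: "T = (\<lambda>p. Q *v p + b)"
    unfolding orientation_preserving_isometry_iff_rotation_translation by blast
  have "Q = R"
    unfolding R_def using T
    by (intro rotation_to_horizontal_unique[OF assms(1) Q]) (simp add: Tp linear_part_def)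
  moreover have "b = - (Q *v \<alpha> s)"
    using T by (simp add: Tp eq_neg_iff_add_eq_0 add.commute)
  ultimately show "T = (\<lambda>p. R *v p - R *v \<alpha> s)"
    by (simp add: Tp)
qed

text \<open>
  The within-derivative is determined by the function only at limit points of the domain;
  a nondegenerate interval consists of such points, including its endpoints.
\<close>
lemma velocity_component:
  assumes "regular_curve I \<alpha>" "s \<in> I" and f: "\<And>u. u \<in> I \<Longrightarrow> f u = \<alpha> u $ i"
  shows "vector_derivative f (at s within I) = velocity I \<alpha> s $ i"
proof (rule vector_derivative_within)
  have "I \<noteq> {a}" for a
    using assms(1) by (auto simp: regular_curve_def)
  moreover have "connected I"
    using assms(1) by (simp add: regular_curve_def is_interval_connected)
  ultimately have "s islimpt I"
    using assms(2) by (intro connected_imp_perfect) auto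
  then show "at s within I \<noteq> bot"
    by (simp add: trivial_limit_within)
  have "(\<alpha> has_vector_derivative velocity I \<alpha> s) (at s within I)"
    using assms(1,2) by (simp add: regular_curve_def velocity_def flip: vector_derivative_works)
  then have "((\<lambda>u. \<alpha> u $ i) has_vector_derivative velocity I \<alpha> s $ i) (at s within I)"
    by (rule bounded_linear.has_vector_derivative[OF bounded_linear_vec_nth])
  then show "(f has_vector_derivative velocity I \<alpha> s $ i) (at s within I)"
    using f assms(2) by (rule_tac has_vector_derivative_transform) auto
qed

theorem theorem1p2:
  fixes I :: "real set"
    and \<alpha> :: "real \<Rightarrow> real^2"
    and x z x' z' \<xi>\<^sub>1 \<xi>\<^sub>2 :: "real \<Rightarrow> real"
  assumes "regular_curve I \<alpha>"
    and "arc_length_parametrized I \<alpha>"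
    and "\<And>s. s \<in> I \<Longrightarrow> \<alpha> s = vector [x s, z s]"
    and "\<And>s. s \<in> I \<Longrightarrow> x' s = vector_derivative x (at s within I)"
    and "\<And>s. s \<in> I \<Longrightarrow> z' s = vector_derivative z (at s within I)"
    and "\<And>s. s \<in> I \<Longrightarrow> \<xi>\<^sub>1 s = x s * x' s + z s * z' s"
    and "\<And>s. s \<in> I \<Longrightarrow> \<xi>\<^sub>2 s = - (x s * z' s) + z s * x' s"
  shows "\<forall>s\<in>I. treadmill_sled I \<alpha> s = - vector [\<xi>\<^sub>1 s, \<xi>\<^sub>2 s]"
proof
  fix s assume s: "s \<in> I"
  have unit: "norm (velocity I \<alpha> s) = 1"
    using assms(2) s by (simp add: arc_length_parametrized_def)
  then have tangent: "unit_tangent I \<alpha> s = velocity I \<alpha> s"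
    by (simp add: unit_tangent_def sgn_div_norm)
  have "x' s = velocity I \<alpha> s $ 1" "z' s = velocity I \<alpha> s $ 2"
    using assms(3-5) s by (simp_all add: velocity_component[OF assms(1)])
  then have "rotation_to_horizontal (velocity I \<alpha> s) *v \<alpha> s = vector [\<xi>\<^sub>1 s, \<xi>\<^sub>2 s]"
    by (simp add: rotation_to_horizontal_mult assms(3)[OF s] assms(6)[OF s] assms(7)[OF s] mult.commute)
  then show "treadmill_sled I \<alpha> s = - vector [\<xi>\<^sub>1 s, \<xi>\<^sub>2 s]"
    using unit by (simp add: treadmill_sled_def treadmill_isometry_eq tangent)
qed

end
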